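(* Let $G$ be an infinite, locally finite, connected, claw-free graph such that for every induced bull $B \subseteq G$ the horns of $B$ have a common neighbour in $G-B$. Then $G$ is bull-free.
   Context: Graphs are undirected and simple. A graph is locally finite if every vertex has finite degree. A graph is $H$-free if it has no induced subgraph isomorphic to $H$. The claw is $K_{1,3}$. The bull is the graph on five vertices obtained from a triangle by attaching one pendant (degree $1$) vertex to each of two distinct vertices of the triangle; its two vertices of degree $1$ are called its horns. An induced bull of $G$ is an induced subgraph of $G$ isomorphic to the bull. $G-B$ denotes $G-V(B)$; a common neighbour in $G-B$ is a vertex of $V(G)\setminus V(B)$ adjacent in $G$ to both horns. *)

theory Defs
  imports "Graph_Theory.Graph_Theory"
begin

(* A simple undirected graph, possibly infinite, is a pair digraph satisfying
   pair_bidirected_digraph (symmetric, without loops): an undirected edge uv is the two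
   arcs (u,v) and (v,u), and since arcs are pairs there are no parallel edges.
   The degree of a vertex of such a graph is therefore its out-degree. *)

(* Stated through finiteness of the arc set, since out_degree is 0 at a vertex of infinite degree. *)
definition locally_finite :: "('a, 'b) pre_digraph \<Rightarrow> bool" where
  "locally_finite G \<longleftrightarrow> (\<forall>v \<in> verts G. finite (out_arcs G v))"

definition induced_copy :: "('c, 'd) pre_digraph \<Rightarrow> ('a, 'b) pre_digraph \<Rightarrow> ('a, 'b) pre_digraph \<Rightarrow> bool" where
  "induced_copy H B G \<longleftrightarrow> induced_subgraph B G \<and> digraph_iso H B"

definition induced_free :: "('c, 'd) pre_digraph \<Rightarrow> ('a, 'b) pre_digraph \<Rightarrow> bool" where
  "induced_free H G \<longleftrightarrow> \<not> (\<exists>B. induced_copy H B G)"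

definition graph_of_edges :: "'a set \<Rightarrow> 'a rel \<Rightarrow> 'a pair_pre_digraph" where
  "graph_of_edges V E = \<lparr> pverts = V, parcs = E \<union> E\<inverse> \<rparr>"

(* Centre 0. *)
definition claw :: "nat pair_pre_digraph" where
  "claw = graph_of_edges {0, 1, 2, 3} {(0, 1), (0, 2), (0, 3)}"

(* Triangle 0, 1, 2; pendant vertex 3 attached to 0 and pendant vertex 4 attached to 1. *)
definition bull :: "nat pair_pre_digraph" where
  "bull = graph_of_edges {0, 1, 2, 3, 4} {(0, 1), (1, 2), (0, 2), (0, 3), (1, 4)}"

definition horns :: "('a, 'b) pre_digraph \<Rightarrow> 'a set" where
  "horns B = {v \<in> verts B. out_degree B v = 1}"

lemma pair_graph_of_edges:
  assumes "finite V" "E \<subseteq> V \<times> V" "irrefl E"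
  shows "pair_graph (graph_of_edges V E)"
proof -
  have "finite E" using assms finite_subset by blast
  with assms show ?thesis
    by unfold_locales
      (auto simp: graph_of_edges_def symmetric_def irrefl_def intro: sym_Un_converse)
qed

lemma claw_K13: "K\<^bsub>1,3\<^esub> (with_proj claw)"
proof -
  have "pair_graph claw"
    unfolding claw_def by (rule pair_graph_of_edges) (auto simp: irrefl_def)
  then interpret pair_graph claw .
  have "graph (with_proj claw)" by unfold_locales
  moreover have "verts (with_proj claw) = {0} \<union> {1, 2, 3}"
    by (auto simp: claw_def graph_of_edges_def)
  moreover have "arcs_ends (with_proj claw) = {0} \<times> {1, 2, 3} \<union> {1, 2, 3} \<times> {0}"
    by (auto simp: claw_def graph_of_edges_def)
  moreover have "{0} \<inter> {1, 2, 3 :: nat} = {}" "card {0 :: nat} = 1" "card {1, 2, 3 :: nat} = 3"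
    by auto
  ultimately show ?thesis
    unfolding complete_bipartite_digraph_def by (intro conjI exI) assumption+
qed

lemma pair_graph_bull: "pair_graph bull"
  unfolding bull_def by (rule pair_graph_of_edges) (auto simp: irrefl_def)

lemma horns_bull: "horns (with_proj bull) = {3, 4}"
proof -
  have "out_arcs (with_proj bull) 0 = {(0, 1), (0, 2), (0, 3)}"
       "out_arcs (with_proj bull) 1 = {(1, 0), (1, 2), (1, 4)}"
       "out_arcs (with_proj bull) 2 = {(2, 0), (2, 1)}"
       "out_arcs (with_proj bull) 3 = {(3, 0)}"
       "out_arcs (with_proj bull) 4 = {(4, 1)}"
    by (auto simp: out_arcs_def bull_def graph_of_edges_def)
  then have d: "out_degree (with_proj bull) 0 = 3" "out_degree (with_proj bull) 1 = 3"
       "out_degree (with_proj bull) 2 = 2" "out_degree (with_proj bull) 3 = 1"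
       "out_degree (with_proj bull) 4 = 1"
    by (simp_all add: out_degree_def)
  have "pverts bull = {0, 1, 2, 3, 4}"
    by (simp add: bull_def graph_of_edges_def)
  then show ?thesis
    using d by (auto simp: horns_def)
qed

end

theory Submission
  imports Defs
begin

text \<open>
  The two horns of an induced bull are at distance two, so no induced bull has horns at
  distance three or more. Suppose there is an induced bull, with vertex set \<open>S\<close>. The graph is
  infinite, connected and locally finite, so it has a vertex outside the ball of radius two around
  \<open>S\<close>, and hence a path \<open>v1, v2, v3\<close> whose vertices are at distance 1, 2, 3 from \<open>S\<close>
  (\<open>exists_path_leaving\<close>). This path already contradicts the bull.

  Consider the neighbours of \<open>v1\<close> in \<open>S\<close>. Any vertex \<open>u\<close> that is adjacent to \<open>v2\<close> has no
  neighbour in \<open>S\<close> besides those of \<open>v1\<close>: otherwise there is an induced bull on the triangle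
  \<open>u, v1, v2\<close> with a horn \<open>v3\<close> and a horn in \<open>S\<close>, and these are too far apart
  (\<open>back_neighbour\<close>). From this it follows that \<open>v1\<close> has no common neighbour with a vertex \<open>s\<close> of
  \<open>S\<close> if \<open>s\<close> is nonadjacent to \<open>v1\<close> and to some neighbour of \<open>v1\<close> in \<open>S\<close>
  (\<open>no_common_neighbour\<close>). But whichever vertices of the bull \<open>v1\<close> is adjacent to, either there is
  a claw, or the bull itself or the hypothesis on horns provides such a common neighbour.
\<close>

section \<open>Claws and bulls as adjacency patterns\<close>

text \<open>
  The triangle is \<open>a, b, c\<close>; the horn \<open>x\<close> hangs at \<open>a\<close> and the horn \<open>y\<close> at \<open>b\<close>. For a symmetric
  irreflexive relation these conditions force the five vertices to be distinct.
\<close>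

definition induced_bull :: "('a \<Rightarrow> 'a \<Rightarrow> bool) \<Rightarrow> 'a \<Rightarrow> 'a \<Rightarrow> 'a \<Rightarrow> 'a \<Rightarrow> 'a \<Rightarrow> bool" where
  "induced_bull adj a b c x y \<longleftrightarrow>
    adj a b \<and> adj b c \<and> adj a c \<and> adj a x \<and> adj b y \<and>
    \<not> adj x b \<and> \<not> adj x c \<and> \<not> adj x y \<and> \<not> adj y a \<and> \<not> adj y c"

locale claw_free_linked_horns =
  fixes adj :: "'a \<Rightarrow> 'a \<Rightarrow> bool"  (infix "\<frown>" 50)
  assumes adj_sym: "u \<frown> v \<Longrightarrow> v \<frown> u"
    and claw_free: "\<lbrakk>c \<frown> x; c \<frown> y; c \<frown> z; x \<noteq> y; x \<noteq> z; y \<noteq> z\<rbrakk> \<Longrightarrow> x \<frown> y \<or> x \<frown> z \<or> y \<frown> z"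
    and horns_linked: "induced_bull (\<frown>) a b c x y \<Longrightarrow> \<exists>w. x \<frown> w \<and> y \<frown> w"
begin

lemma adj_commute: "u \<frown> v \<longleftrightarrow> v \<frown> u"
  using adj_sym by blast

lemma induced_bull_swap: "induced_bull (\<frown>) a b c x y \<Longrightarrow> induced_bull (\<frown>) b a c y x"
  by (simp add: induced_bull_def adj_commute)

end

section \<open>A path leaving a vertex set\<close>

text \<open>
  The conditions say that \<open>v1, v2, v3\<close> are at distance 1, 2, 3 from \<open>S\<close>; in particular none of them
  lies in \<open>S\<close>.
\<close>

locale path_leaving = claw_free_linked_horns +
  fixes S :: "'a set" and v1 v2 v3 :: 'a
  assumes v1_v2: "v1 \<frown> v2" and v2_v3: "v2 \<frown> v3"
    and v1_S: "\<exists>s\<in>S. s \<frown> v1"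
    and v2_S: "s \<in> S \<Longrightarrow> \<not> s \<frown> v2"
    and v3_S: "s \<in> S \<Longrightarrow> \<not> s \<frown> v3"
    and v3_dist: "\<lbrakk>s \<in> S; u \<frown> s\<rbrakk> \<Longrightarrow> \<not> u \<frown> v3"
begin

lemma v1_v3: "\<not> v1 \<frown> v3"
  using v1_S v3_dist adj_sym by blast

lemma v2_notin: "v2 \<notin> S"
  using v2_v3 v3_S by blast

text \<open>
  If \<open>s\<close> were not adjacent to \<open>v1\<close>, then \<open>u, v1, v2\<close> would be a triangle (else \<open>v2\<close> is the centre of
  a claw with the leaves \<open>u, v1, v3\<close>), and the pendant vertices \<open>v3\<close> at \<open>v2\<close> and \<open>s\<close> at \<open>u\<close> would
  be horns at distance three.
\<close>

lemma back_neighbour: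
  assumes "s \<in> S" "u \<frown> s" "u \<frown> v2"
  shows "s \<frown> v1"
proof (rule ccontr)
  assume s_v1: "\<not> s \<frown> v1"
  have u_v3: "\<not> u \<frown> v3" using assms v3_dist by blast
  have "u \<noteq> v1" "u \<noteq> v3" "v1 \<noteq> v3"
    using s_v1 assms adj_sym v3_S v1_S by blast+
  then have "u \<frown> v1"
    using claw_free[of v2 u v1 v3] assms v1_v2 v2_v3 u_v3 v1_v3 by (auto simp: adj_commute)
  then have bull: "induced_bull (\<frown>) v2 u v1 v3 s"
    using assms u_v3 v1_v3 s_v1 v1_v2 v2_v3 v2_S[of s] v3_S[of s]
    by (simp add: induced_bull_def adj_commute)
  obtain w where "v3 \<frown> w" "s \<frown> w"
    using horns_linked[OF bull] by blast
  then show False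
    using v3_dist[of s w] assms by (simp add: adj_commute)
qed

text \<open>
  A common neighbour \<open>z\<close> of \<open>v1\<close> and \<open>s\<close> is not adjacent to \<open>v2\<close>, so it is adjacent to \<open>t\<close> (else
  \<open>v1\<close> is the centre of a claw). The triangle \<open>v1, z, t\<close> with the pendant vertices \<open>v2\<close> and \<open>s\<close> is
  then an induced bull, and a common neighbour of its horns contradicts \<open>back_neighbour\<close>.
\<close>

lemma no_common_neighbour:
  assumes "s \<in> S" "t \<in> S" "t \<frown> v1" "\<not> s \<frown> v1" "\<not> s \<frown> t"
  shows "\<not> (s \<frown> z \<and> v1 \<frown> z)"
proof
  assume z: "s \<frown> z \<and> v1 \<frown> z"
  have z_v2: "\<not> z \<frown> v2" using z assms back_neighbour[of s z] by (auto simp: adj_commute)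
  have "z \<noteq> t" "z \<noteq> v2" "t \<noteq> v2"
    using z assms v2_S v2_notin by blast+
  then have "t \<frown> z"
    using claw_free[of v1 t z v2] z z_v2 assms v1_v2 v2_S[of t] by (auto simp: adj_commute)
  then have bull: "induced_bull (\<frown>) v1 z t v2 s"
    using z z_v2 assms v1_v2 v2_S[of s] v2_S[of t] by (simp add: induced_bull_def adj_commute)
  obtain w where "v2 \<frown> w" "s \<frown> w"
    using horns_linked[OF bull] by blast
  then show False
    using back_neighbour[of s w] assms by (simp add: adj_commute)
qed

lemma neighbours_in_S_adjacent:
  assumes "s \<in> S" "t \<in> S" "s \<frown> v1" "t \<frown> v1" "s \<noteq> t"
  shows "s \<frown> t"
  using claw_free[of v1 s t v2] assms v1_v2 v2_S[of s] v2_S[of t] v2_notin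
  by (auto simp: adj_commute)

section \<open>No neighbour of the path in an induced bull\<close>

text \<open>
  Among \<open>x\<close> and \<open>b\<close> at least one is adjacent to \<open>v1\<close>, as \<open>a\<close> is not the centre of a claw, and at
  least one is not, as otherwise \<open>v1\<close> is the centre of a claw with the leaf \<open>v2\<close>. The one that is
  not has the common neighbour \<open>a\<close> with \<open>v1\<close>, which contradicts \<open>no_common_neighbour\<close>.
\<close>

lemma not_adjacent_triangle_end:
  assumes bull: "induced_bull (\<frown>) a b c x y" and S: "{a, b, x} \<subseteq> S"
  shows "\<not> a \<frown> v1"
proof
  assume a: "a \<frown> v1"
  have xb: "\<not> x \<frown> b" "\<not> b \<frown> x" "x \<noteq> b" and ax: "a \<frown> x" "a \<frown> b"
    using bull by (auto simp: induced_bull_def adj_commute)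
  have "x \<noteq> v1" "b \<noteq> v1" using S v2_S v1_v2 by blast+
  then have "x \<frown> v1 \<or> b \<frown> v1"
    using claw_free[of a v1 x b] a ax xb by (auto simp: adj_commute)
  moreover have "\<not> (x \<frown> v1 \<and> b \<frown> v1)"
    using neighbours_in_S_adjacent[of x b] S xb by blast
  ultimately show False
    using no_common_neighbour[of x b a] no_common_neighbour[of b x a] a ax xb S
    by (auto simp: adj_commute)
qed

text \<open>
  Here \<open>x\<close> at \<open>a\<close> and \<open>v1\<close> at \<open>c\<close> are the horns of another bull on the same triangle. A common
  neighbour of these horns contradicts \<open>no_common_neighbour\<close>, as \<open>x\<close> is nonadjacent to \<open>c\<close>.
\<close>

lemma not_adjacent_triangle_tip:
  assumes bull: "induced_bull (\<frown>) a b c x y" and S: "{a, b, c, x, y} \<subseteq> S"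
  shows "\<not> c \<frown> v1"
proof
  assume c: "c \<frown> v1"
  have "\<not> a \<frown> v1"
    using not_adjacent_triangle_end[OF bull] S by blast
  moreover have "\<not> b \<frown> v1"
    using not_adjacent_triangle_end[OF induced_bull_swap[OF bull]] S by blast
  moreover have x: "\<not> x \<frown> c" "x \<noteq> c"
    using bull by (auto simp: induced_bull_def adj_commute)
  moreover from x have "\<not> x \<frown> v1"
    using neighbours_in_S_adjacent[of x c] c S by blast
  ultimately have bull': "induced_bull (\<frown>) a c b x v1"
    using bull c by (simp add: induced_bull_def adj_commute)
  obtain z where "x \<frown> z" "v1 \<frown> z"
    using horns_linked[OF bull'] by blast
  then show False
    using no_common_neighbour[of x c z] S c x \<open>\<not> x \<frown> v1\<close> by blast
qed

text \<open>
  A common neighbour \<open>w\<close> of the horns is not adjacent to \<open>v1\<close>, so it is adjacent to \<open>a\<close> (else \<open>x\<close> is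
  the centre of a claw). Then \<open>v1\<close> at \<open>x\<close> and \<open>y\<close> at \<open>w\<close> are the horns of a bull on \<open>x, w, a\<close>,
  and their common neighbour contradicts \<open>no_common_neighbour\<close>, as \<open>y\<close> is nonadjacent to \<open>x\<close>.
\<close>

lemma not_adjacent_horn:
  assumes bull: "induced_bull (\<frown>) a b c x y" and S: "{a, b, c, x, y} \<subseteq> S"
  shows "\<not> x \<frown> v1"
proof
  assume x: "x \<frown> v1"
  have a: "\<not> a \<frown> v1"
    using not_adjacent_triangle_end[OF bull] S by blast
  have y: "\<not> y \<frown> x" "\<not> y \<frown> a" "x \<noteq> y" "a \<frown> x"
    using bull by (auto simp: induced_bull_def adj_commute)
  have y_v1: "\<not> y \<frown> v1"
    using neighbours_in_S_adjacent[of x y] x y S by (auto simp: adj_commute)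
  note no_common = no_common_neighbour[of y x, OF _ _ x y_v1 y(1)]
  obtain w where w: "x \<frown> w" "y \<frown> w"
    using horns_linked[OF bull] by blast
  then have w_v1: "\<not> v1 \<frown> w"
    using no_common S by blast
  have "a \<noteq> w" "v1 \<noteq> w" "a \<noteq> v1"
    using w y y_v1 S v2_S v1_v2 by blast+
  then have "a \<frown> w"
    using claw_free[of x a v1 w] a x y w w_v1 by (auto simp: adj_commute)
  then have bull': "induced_bull (\<frown>) x w a v1 y"
    using x y y_v1 w w_v1 a by (simp add: induced_bull_def adj_commute)
  obtain z where "v1 \<frown> z" "y \<frown> z"
    using horns_linked[OF bull'] by blast
  then show False
    using no_common S by blast
qed

lemma not_bull:
  assumes "S = {a, b, c, x, y}"
  shows "\<not> induced_bull (\<frown>) a b c x y"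
proof
  assume bull: "induced_bull (\<frown>) a b c x y"
  note bull' = induced_bull_swap[OF bull]
  obtain s where "s \<in> {a, b, c, x, y}" "s \<frown> v1"
    using v1_S assms by blast
  moreover have "\<not> a \<frown> v1" "\<not> b \<frown> v1" "\<not> c \<frown> v1" "\<not> x \<frown> v1" "\<not> y \<frown> v1"
    using not_adjacent_triangle_end[OF bull] not_adjacent_triangle_end[OF bull']
      not_adjacent_triangle_tip[OF bull] not_adjacent_horn[OF bull] not_adjacent_horn[OF bull']
      assms
    by simp_all
  ultimately show False by auto
qed

end

section \<open>Leaving a finite vertex set in an infinite graph\<close>

lemma rtrancl_crosses:
  assumes "(u, v) \<in> R\<^sup>*" "u \<in> A" "v \<notin> A"
  shows "\<exists>(p, q)\<in>R. p \<in> A \<and> q \<notin> A"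
  using assms by (induction rule: rtrancl_induct) auto

lemma (in pair_sym_digraph) connected_rtrancl:
  assumes "Digraph_Component.connected (with_proj G)" "u \<in> pverts G" "v \<in> pverts G"
  shows "(u, v) \<in> (parcs G)\<^sup>*"
proof -
  have "parcs (mk_symmetric (with_proj G)) = parcs G"
    by (auto simp: mk_symmetric_def intro: arcs_symmetric)
  moreover have "u \<rightarrow>\<^sup>*\<^bsub>with_proj (mk_symmetric (with_proj G))\<^esub> v"
    using assms
    by (auto simp: Digraph_Component.connected_def strongly_connected_def mk_symmetric_def)
  ultimately show ?thesis
    by (auto simp: reachable_def dest: rtrancl_on_rtranclI)
qed

lemma finite_closed_neighbourhood:
  assumes "locally_finite (with_proj G)" "finite A" "A \<subseteq> pverts G"
  shows "finite (A \<union> parcs G `` A)"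
proof -
  have "parcs G `` A = (\<Union>v\<in>A. snd ` out_arcs (with_proj G) v)"
    by (force simp: out_arcs_def)
  then show ?thesis
    using assms by (auto simp: locally_finite_def)
qed

text \<open>
  The ball of radius two around \<open>S\<close> is finite, so some edge \<open>v2 v3\<close> leaves it.
\<close>

lemma (in pair_sym_digraph) exists_path_leaving:
  assumes "infinite (pverts G)" "locally_finite (with_proj G)"
    and "Digraph_Component.connected (with_proj G)"
    and S: "finite S" "S \<subseteq> pverts G" "S \<noteq> {}"
  shows "\<exists>v1 v2 v3. (v1, v2) \<in> parcs G \<and> (v2, v3) \<in> parcs G \<and> (\<exists>s\<in>S. (s, v1) \<in> parcs G) \<and>
    (\<forall>s\<in>S. (s, v2) \<notin> parcs G \<and> (s, v3) \<notin> parcs G \<and>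
      (\<forall>u. (s, u) \<in> parcs G \<longrightarrow> (u, v3) \<notin> parcs G))"
proof -
  define N where "N = (\<lambda>A. A \<union> parcs G `` A)"
  have N: "finite (N A) \<and> N A \<subseteq> pverts G" if "finite A" "A \<subseteq> pverts G" for A
    using that finite_closed_neighbourhood[OF assms(2)] in_arcsD2 by (auto simp: N_def)
  have "finite (N (N S))" using N[of S] N[of "N S"] S by simp
  then obtain z where z: "z \<in> pverts G" "z \<notin> N (N S)"
    using assms(1) finite_subset[of "pverts G" "N (N S)"] by blast
  obtain s where "s \<in> S" using S by blast
  then have "s \<in> N (N S)" "(s, z) \<in> (parcs G)\<^sup>*"
    using connected_rtrancl[OF assms(3)] S z by (auto simp: N_def)
  then obtain v2 v3 where v: "(v2, v3) \<in> parcs G" "v2 \<in> N (N S)" "v3 \<notin> N (N S)"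
    using rtrancl_crosses[of s z "parcs G" "N (N S)"] z by auto
  then have v2: "v2 \<notin> N S" by (auto simp: N_def)
  with v obtain v1 where "v1 \<in> N S" "(v1, v2) \<in> parcs G" by (auto simp: N_def)
  moreover from this v2 have "\<exists>s\<in>S. (s, v1) \<in> parcs G" by (auto simp: N_def)
  moreover have "\<forall>s\<in>S. (s, v2) \<notin> parcs G" using v2 by (auto simp: N_def)
  moreover have "\<forall>s\<in>S. (s, v3) \<notin> parcs G \<and> (\<forall>u. (s, u) \<in> parcs G \<longrightarrow> (u, v3) \<notin> parcs G)"
    using v(3) by (auto simp: N_def)
  ultimately show ?thesis using v(1) by blast
qed

section \<open>Induced copies as embeddings\<close>

text \<open>
  An isomorphism of digraphs may rename arcs arbitrarily. Its image is here a subgraph of a graph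
  whose arcs are pairs, so the set of arcs of the image coincides with its set of end pairs, and
  adjacency can be read off from the vertex map alone.
\<close>

lemma induced_copy_embedding:
  assumes "induced_copy (with_proj H) B (with_proj G)"
  obtains f where "\<And>i j. \<lbrakk>i \<in> pverts H; j \<in> pverts H\<rbrakk> \<Longrightarrow>
      (i, j) \<in> parcs H \<longleftrightarrow> (f i, f j) \<in> parcs G"
    and "f ` pverts H \<subseteq> pverts G"
proof -
  obtain h where h: "pre_digraph.digraph_isomorphism (with_proj H) h"
    and B: "B = app_iso h (with_proj H)" and sub: "induced_subgraph B (with_proj G)"
    using assms by (auto simp: induced_copy_def digraph_iso_def)
  let ?f = "iso_verts h"
  have wf: "wf_digraph (with_proj H)" and inj: "inj_on ?f (pverts H)"
    using h by (auto simp: pre_digraph.digraph_isomorphism_def)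
  have ends: "arcs_ends B = map_prod ?f ?f ` parcs H"
    using wf_digraph.arcs_ends_app_iso_eq[OF wf h] by (simp add: B map_prod_def)
  have "tail B = fst" "head B = snd"
    and arcs: "arcs B = {e \<in> parcs G. fst e \<in> ?f ` pverts H \<and> snd e \<in> ?f ` pverts H}"
    and V: "?f ` pverts H \<subseteq> pverts G"
    using sub by (auto simp: induced_subgraph_def subgraph_def compatible_def B)
  then have "arcs_ends B = arcs B" by (auto simp: arcs_ends_conv)
  with ends arcs have *: "map_prod ?f ?f ` parcs H =
      {e \<in> parcs G. fst e \<in> ?f ` pverts H \<and> snd e \<in> ?f ` pverts H}" by simp
  have "(i, j) \<in> parcs H \<longleftrightarrow> (?f i, ?f j) \<in> parcs G" if ij: "i \<in> pverts H" "j \<in> pverts H" for i j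
  proof -
    have "parcs H \<subseteq> pverts H \<times> pverts H"
      using wf_digraph.wellformed[OF wf] by auto
    then have "(i, j) \<in> parcs H \<longleftrightarrow> map_prod ?f ?f (i, j) \<in> map_prod ?f ?f ` parcs H"
      using ij by (intro inj_on_image_mem_iff[symmetric, OF map_prod_inj_on[OF inj inj]]) auto
    then show ?thesis using ij by (auto simp: *)
  qed
  then show ?thesis using V that by blast
qed

lemma horns_app_iso:
  assumes "wf_digraph H" "pre_digraph.digraph_isomorphism H h"
  shows "horns (app_iso h H) = iso_verts h ` horns H"
  using wf_digraph.out_degree_app_iso_eq[OF assms] by (auto simp: horns_def)

lemma embedding_induced_copy:
  assumes G: "pair_wf_digraph G" and H: "pair_wf_digraph H"
    and inj: "inj_on f (pverts H)" and V: "f ` pverts H \<subseteq> pverts G"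
    and arcs: "\<And>i j. \<lbrakk>i \<in> pverts H; j \<in> pverts H\<rbrakk> \<Longrightarrow>
      (i, j) \<in> parcs H \<longleftrightarrow> (f i, f j) \<in> parcs G"
  obtains B where "induced_copy (with_proj H) B (with_proj G)"
    and "horns B = f ` horns (with_proj H)"
proof -
  interpret H: pair_wf_digraph H by fact
  define h where "h = \<lparr>iso_verts = f, iso_arcs = map_prod f f, iso_head = snd, iso_tail = fst\<rparr>"
  define B where "B = app_iso h (with_proj H)"
  have sub: "parcs H \<subseteq> pverts H \<times> pverts H"
    using H.in_arcsD1 H.in_arcsD2 by auto
  have h: "H.digraph_isomorphism h"
    unfolding H.digraph_isomorphism_def
    using inj map_prod_inj_on[OF inj inj] sub H.wf_digraph_axioms
    by (auto simp: h_def intro: inj_on_subset)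
  have wfB: "wf_digraph B" unfolding B_def using h by (rule H.wf_digraphI_app_iso)
  have "map_prod f f ` parcs H =
      {e \<in> parcs G. fst e \<in> f ` pverts H \<and> snd e \<in> f ` pverts H}"
    using sub arcs by (force simp: image_iff)
  then have "induced_subgraph B (with_proj G)"
    using V wfB G
    by (auto simp: induced_subgraph_def subgraph_def compatible_def B_def h_def wf_digraph_wp_iff)
  then have "induced_copy (with_proj H) B (with_proj G)"
    using h by (auto simp: induced_copy_def digraph_iso_def B_def)
  moreover have "horns B = f ` horns (with_proj H)"
    using horns_app_iso[OF H.wf_digraph_axioms h] by (simp add: B_def h_def)
  ultimately show ?thesis using that by blast
qed

lemma pair_graph_claw: "pair_graph claw"
  unfolding claw_def by (rule pair_graph_of_edges) (auto simp: irrefl_def)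

context pair_bidirected_digraph
begin

lemma induced_copy_claw:
  assumes "(c, x) \<in> parcs G" "(c, y) \<in> parcs G" "(c, z) \<in> parcs G"
    and "x \<noteq> y" "x \<noteq> z" "y \<noteq> z"
    and "(x, y) \<notin> parcs G" "(x, z) \<notin> parcs G" "(y, z) \<notin> parcs G"
  obtains B where "induced_copy (with_proj claw) B (with_proj G)"
proof -
  interpret C: pair_graph claw by (rule pair_graph_claw)
  let ?f = "\<lambda>i. [c, x, y, z] ! i"
  have loops: "(v, v) \<notin> parcs G" for v using no_loops' by blast
  have sym: "(u, v) \<in> parcs G \<longleftrightarrow> (v, u) \<in> parcs G" for u v using arcs_symmetric by blast
  have claw: "pverts claw = {0, 1, 2, 3}"
    "parcs claw = {(0, 1), (0, 2), (0, 3), (1, 0), (2, 0), (3, 0)}"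
    by (auto simp: claw_def graph_of_edges_def)
  have ne: "c \<noteq> x" "c \<noteq> y" "c \<noteq> z" using assms loops by blast+
  show ?thesis
  proof (rule embedding_induced_copy[of G claw ?f])
    show "inj_on ?f (pverts claw)"
      using assms ne by (auto simp: claw inj_on_def)
    show "?f ` pverts claw \<subseteq> pverts G"
      using assms in_arcsD1 in_arcsD2 by (auto simp: claw)
    have "\<forall>i\<in>pverts claw. \<forall>j\<in>pverts claw. (i, j) \<in> parcs claw \<longleftrightarrow> (?f i, ?f j) \<in> parcs G"
      using assms by (simp add: claw loops sym)
    then show "(i, j) \<in> parcs claw \<longleftrightarrow> (?f i, ?f j) \<in> parcs G"
      if "i \<in> pverts claw" "j \<in> pverts claw" for i j
      using that by blast
  qed (use that pair_wf_digraph_axioms C.pair_wf_digraph_axioms in blast)+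
qed

lemma induced_copy_bull:
  assumes bull: "induced_bull (\<lambda>u v. (u, v) \<in> parcs G) a b c x y"
  obtains B where "induced_copy (with_proj bull) B (with_proj G)" "horns B = {x, y}"
proof -
  interpret B: pair_graph bull by (rule pair_graph_bull)
  let ?f = "\<lambda>i. [a, b, c, x, y] ! i"
  have loops: "(v, v) \<notin> parcs G" for v using no_loops' by blast
  have sym: "(u, v) \<in> parcs G \<longleftrightarrow> (v, u) \<in> parcs G" for u v using arcs_symmetric by blast
  note bull = bull[unfolded induced_bull_def]
  have bull_simps: "pverts bull = {0, 1, 2, 3, 4}"
    "parcs bull = {(0, 1), (1, 2), (0, 2), (0, 3), (1, 4), (1, 0), (2, 1), (2, 0), (3, 0), (4, 1)}"
    by (auto simp: bull_def graph_of_edges_def)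
  have ne: "a \<noteq> b" "a \<noteq> c" "a \<noteq> x" "a \<noteq> y" "b \<noteq> c" "b \<noteq> x" "b \<noteq> y" "c \<noteq> x" "c \<noteq> y" "x \<noteq> y"
    using bull loops sym by blast+
  show ?thesis
  proof (rule embedding_induced_copy[of G bull ?f])
    show "inj_on ?f (pverts bull)"
      using ne by (auto simp: bull_simps inj_on_def)
    show "?f ` pverts bull \<subseteq> pverts G"
      using bull in_arcsD1 in_arcsD2 by (auto simp: bull_simps)
    have "\<forall>i\<in>pverts bull. \<forall>j\<in>pverts bull. (i, j) \<in> parcs bull \<longleftrightarrow> (?f i, ?f j) \<in> parcs G"
      using bull by (simp add: bull_simps loops sym)
    then show "(i, j) \<in> parcs bull \<longleftrightarrow> (?f i, ?f j) \<in> parcs G"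
      if "i \<in> pverts bull" "j \<in> pverts bull" for i j
      using that by blast
  next
    fix B assume "induced_copy (with_proj bull) B (with_proj G)" "horns B = ?f ` horns (with_proj bull)"
    then show thesis using that by (simp add: horns_bull)
  qed (use pair_wf_digraph_axioms B.pair_wf_digraph_axioms in blast)+
qed

lemma induced_bull_of_copy:
  assumes "induced_copy (with_proj bull) B (with_proj G)"
  obtains a b c x y where "induced_bull (\<lambda>u v. (u, v) \<in> parcs G) a b c x y"
    and "{a, b, c, x, y} \<subseteq> pverts G"
proof -
  obtain f where f: "\<And>i j. \<lbrakk>i \<in> pverts bull; j \<in> pverts bull\<rbrakk> \<Longrightarrow>
      (i, j) \<in> parcs bull \<longleftrightarrow> (f i, f j) \<in> parcs G"
    and V: "f ` pverts bull \<subseteq> pverts G"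
    using induced_copy_embedding[OF assms] by blast
  have "induced_bull (\<lambda>u v. (u, v) \<in> parcs G) (f 0) (f 1) (f 2) (f 3) (f 4)"
    unfolding induced_bull_def by (simp add: f[symmetric] bull_def graph_of_edges_def)
  then show ?thesis
    using that V by (simp add: bull_def graph_of_edges_def)
qed

end

section \<open>Claw-free graphs with linked horns\<close>

theorem theorem1p8:
  fixes G :: "'a pair_pre_digraph"
  assumes "pair_bidirected_digraph G"
    and "infinite (pverts G)"
    and "locally_finite (with_proj G)"
    and "Digraph_Component.connected (with_proj G)"
    and "induced_free (with_proj claw) (with_proj G)"
    and "\<And>B. induced_copy (with_proj bull) B (with_proj G) \<Longrightarrow>
           \<exists>w \<in> pverts G - verts B. \<forall>h \<in> horns B. h \<rightarrow>\<^bsub>with_proj G\<^esub> w"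
  shows "induced_free (with_proj bull) (with_proj G)"
proof -
  interpret pair_bidirected_digraph G by fact
  let ?adj = "\<lambda>u v. (u, v) \<in> parcs G"
  interpret claw_free_linked_horns ?adj
  proof
    show "?adj v u" if "?adj u v" for u v using that by (rule arcs_symmetric)
    show "?adj x y \<or> ?adj x z \<or> ?adj y z"
      if "?adj c x" "?adj c y" "?adj c z" "x \<noteq> y" "x \<noteq> z" "y \<noteq> z" for c x y z
      using that assms(5) induced_copy_claw[of c x y z] unfolding induced_free_def by blast
    show "\<exists>w. ?adj x w \<and> ?adj y w" if bull: "induced_bull ?adj a b c x y" for a b c x y
    proof -
      obtain B where "induced_copy (with_proj bull) B (with_proj G)" "horns B = {x, y}"
        using induced_copy_bull[OF bull] .
      then show ?thesis using assms(6)[of B] by auto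
    qed
  qed
  have "False" if B: "induced_copy (with_proj bull) B (with_proj G)" for B
  proof -
    obtain a b c x y where bull: "induced_bull ?adj a b c x y" "{a, b, c, x, y} \<subseteq> pverts G"
      using induced_bull_of_copy[OF B] .
    let ?S = "{a, b, c, x, y}"
    have "finite ?S" "?S \<noteq> {}" by simp_all
    with exists_path_leaving[OF assms(2-4) _ bull(2)] obtain v1 v2 v3
      where v: "?adj v1 v2" "?adj v2 v3" "\<exists>s\<in>?S. ?adj s v1"
        and far: "\<forall>s\<in>?S. \<not> ?adj s v2 \<and> \<not> ?adj s v3 \<and> (\<forall>u. ?adj s u \<longrightarrow> \<not> ?adj u v3)"
      by auto
    interpret path_leaving ?adj ?S v1 v2 v3
    proof
      show "\<not> ?adj u v3" if "s \<in> ?S" "?adj u s" for s u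
        using far that adj_sym[of u s] by blast
    qed (use v far in blast)+
    show False using not_bull[OF refl] bull(1) by blast
  qed
  then show ?thesis unfolding induced_free_def by blast
qed

end
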